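(* Let $(a,b,c)$ be a triple of positive integers with $a=b+c$ (so $a=n/2$ where $n=a+b+c$) and with $b$ and $c$ relatively prime. Then $(a,b,c)$ is a good triple.
   Context: For positive integers $a,b,c$ with $n=a+b+c$, the permutation of the triple $(a,b,c)$ is the permutation of $[n]$ with $p_i=n+1-i$ for $1\le i\le a$, $p_i=a+b+1-i$ for $a+1\le i\le a+b$, and $p_i=n+b+1-i$ for $a+b+1\le i\le n$ (one-line notation $n\cdots(n-a+1)\ b\cdots1\ (b+c)\cdots(b+1)$). The triple is good if this permutation, as a bijection $i\mapsto p_i$ of $[n]$, is a single $n$-cycle. *)

theory Defs
  imports "HOL-Combinatorics.Orbits"
begin

text \<open>Each branch is reached only when its subtraction does not truncate.
  Outside \<open>{1..a + b + c}\<close> the map is the identity.\<close>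

definition triple_perm :: "nat \<Rightarrow> nat \<Rightarrow> nat \<Rightarrow> nat \<Rightarrow> nat" where
  "triple_perm a b c i =
     (let n = a + b + c in
      if 1 \<le> i \<and> i \<le> a then n + 1 - i
      else if a + 1 \<le> i \<and> i \<le> a + b then a + b + 1 - i
      else if a + b + 1 \<le> i \<and> i \<le> n then n + b + 1 - i
      else i)"

lemma triple_perm_permutes: "triple_perm a b c permutes {1..a + b + c}"
proof (rule bij_imp_permutes)
  have inj: "inj_on (triple_perm a b c) {1..a + b + c}"
    by (rule inj_onI) (auto simp: triple_perm_def Let_def split: if_splits)
  have "triple_perm a b c ` {1..a + b + c} \<subseteq> {1..a + b + c}"
    by (auto simp: triple_perm_def Let_def)
  with inj show "bij_betw (triple_perm a b c) {1..a + b + c} {1..a + b + c}"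
    by (simp add: bij_betw_def endo_inj_surj)
qed (auto simp: triple_perm_def Let_def)

text \<open>Since the map permutes \<open>{1..n}\<close> with \<open>n = a + b + c\<close>, being a single \<open>n\<close>-cycle
  means that \<open>{1..n}\<close> is one orbit.\<close>

definition good_triple :: "nat \<Rightarrow> nat \<Rightarrow> nat \<Rightarrow> bool" where
  "good_triple a b c \<longleftrightarrow> cyclic_on (triple_perm a b c) {1..a + b + c}"

end

theory Submission imports Defs "HOL-Number_Theory.Cong" begin

text \<open>For \<open>a = b + c\<close> the permutation swaps the two halves of \<open>{1..2a}\<close>, and its square acts on
  \<open>{1..a}\<close> as the rotation \<open>i \<mapsto> i + b\<close> modulo \<open>a\<close>. As \<open>b\<close> is coprime to \<open>a\<close>, this rotation is
  transitive on the first half; one more application reaches the second half.\<close>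

lemma triple_perm_twice:
  assumes "b > 0" "c > 0" "x < b + c"
  shows "triple_perm (b + c) b c (triple_perm (b + c) b c (Suc x)) = Suc ((x + b) mod (b + c))"
\<comment> \<open>The first application sends \<open>Suc x\<close> to
  \<open>2 * (b + c) - x\<close>, which lies in the last block exactly when \<open>x < c\<close>;
  this is also when \<open>x + b\<close> does not wrap around.\<close>
proof (cases "x < c")
  case True
  then show ?thesis by (auto simp: triple_perm_def Let_def)
next
  case False
  then have "(x + b) mod (b + c) = x - c"
    using assms by (simp add: mod_if)
  with False assms show ?thesis by (auto simp: triple_perm_def Let_def)
qed

lemma triple_perm_even_iterate:
  assumes "b > 0" "c > 0"
  shows "(triple_perm (b + c) b c ^^ (2 * k)) 1 = Suc (k * b mod (b + c))"
proof (induction k)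
  case (Suc k)
  then show ?case
    using assms triple_perm_twice[of b c "k * b mod (b + c)"]
    by (simp add: mod_simps algebra_simps)
qed simp

lemma first_half_in_orbit:
  assumes "b > 0" "c > 0" "coprime b c" "1 \<le> x" "x \<le> b + c"
  shows "x \<in> orbit (triple_perm (b + c) b c) 1"
proof -
  have "coprime b (b + c)"
    using assms(3) by (simp add: coprime_iff_gcd_eq_1)
  then obtain y where y: "[b * y = 1] (mod (b + c))"
    using cong_solve_coprime_nat by auto
  \<comment> \<open>Since \<open>y\<close> inverts \<open>b\<close>, the first summand yields
    residue \<open>x - 1\<close>. The second keeps the residue and makes the exponent positive even
    for \<open>x = 1\<close>, as \<open>orbit\<close> demands.\<close>
  define k where "k = y * (x - 1) + (b + c)"
  have "[k * b = b * y * (x - 1)] (mod (b + c))"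
  proof -
    have "k * b = b * y * (x - 1) + b * (b + c)"
      by (simp add: k_def distrib_left distrib_right mult_ac)
    then show ?thesis
      by (simp only: cong_def mod_mult_self1)
  qed
  also have "[b * y * (x - 1) = 1 * (x - 1)] (mod (b + c))"
    using y by (rule cong_mult) simp
  finally have "k * b mod (b + c) = x - 1"
    using assms by (simp add: cong_def)
  then have "(triple_perm (b + c) b c ^^ (2 * k)) 1 = x"
    using triple_perm_even_iterate[of b c k] assms by simp
  moreover have "2 * k > 0"
    using assms by (simp add: k_def)
  ultimately show ?thesis
    unfolding orbit_altdef by blast
qed

theorem theorem10:
  fixes a b c :: nat
  assumes "a > 0" and "b > 0" and "c > 0"
    and "a = b + c"
    and "coprime b c"
  shows "good_triple a b c"
proof -
  let ?f = "triple_perm a b c" and ?S = "{1..a + b + c}"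
  have half: "x \<in> orbit ?f 1" if "1 \<le> x" "x \<le> a" for x
    using first_half_in_orbit assms that by simp
  have "?S \<subseteq> orbit ?f 1"
  proof
    fix x assume x: "x \<in> ?S"
    show "x \<in> orbit ?f 1"
    proof (cases "x \<le> a")
      case True
      with x half show ?thesis by simp
    next
      case False
      \<comment> \<open>The first block is the reflection \<open>i \<mapsto> n + 1 - i\<close>, so
        the mirror image of \<open>x\<close> is its preimage; it lies in the first half because
        \<open>a = n / 2\<close>.\<close>
      let ?y = "a + b + c + 1 - x"
      have y: "1 \<le> ?y" "?y \<le> a"
        using x False assms(4) by auto
      then have "?f ?y = x"
        using x by (auto simp: triple_perm_def Let_def)
      then show ?thesis
        using orbit.step[OF half[OF y]] by simp
    qed
  qed
  moreover have "orbit ?f 1 \<subseteq> ?S"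
    using permutes_orbit_subset[OF triple_perm_permutes] assms(1) by simp
  ultimately show ?thesis
    using assms(1) unfolding good_triple_def cyclic_on_def by force
qed

end
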